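(* Let $(\mathcal{A},\cdot,\mathfrak{B})$ be a quadratic Zinbiel superalgebra over a field $\mathbb{K}$, let $\mathcal{V}=\mathbb{K}d$ be the one-dimensional vector space (with $d$ even) with dual $\mathcal{V}^*=\mathbb{K}d^*$, let $\delta$ be an even endomorphism of $\mathcal{A}$ with adjoint $\delta^*$ with respect to $\mathfrak{B}$ (that is, $\mathfrak{B}(\delta(x),y)=\mathfrak{B}(x,\delta^*(y))$ for all $x,y\in\mathcal{A}$), and let $(\delta,\delta^*,\mathfrak{a}_0)$ be an admissible triple of $\mathcal{A}$ such that $\delta(\mathcal{A})\subseteq{\rm Ann}(\mathcal{A})$, $\delta(\mathcal{A}^2)=\{0\}$, $\delta^2=\delta\circ\delta^*=\delta^*\circ\delta=0$, $\mathfrak{a}_0\in{\rm Ann}(\mathcal{A})\cap\mathcal{A}_{\bar 0}$ and $\mathfrak{B}(\mathfrak{a}_0,\mathfrak{a}_0)=0$. Let $\alpha\in\mathbb{K}$. Then the $\mathbb{Z}_2$-graded vector space $\overline{\mathcal{A}}=\mathcal{V}^*\oplus\mathcal{A}\oplus\mathcal{V}$ endowed with the product $$d\odot d=\mathfrak{a}_0+\alpha d^*,\quad d\odot x=\delta(x)+\mathfrak{B}(x,\mathfrak{a}_0)d^*,\quad x\odot y=xy+\mathfrak{B}(\delta(x),y)d^*,\quad x\odot d=\delta^*(x)+\mathfrak{B}(x,\mathfrak{a}_0)d^*,$$ for all $x,y\in\mathcal{A}$ (all products involving $d^*$ being zero), is a symmetric Zinbiel superalgebra. Moreover, the even bilinear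 form $\overline{\mathfrak{B}}:\overline{\mathcal{A}}\times\overline{\mathcal{A}}\to\mathbb{K}$ defined by $\overline{\mathfrak{B}}|_{\mathcal{A}\times\mathcal{A}}=\mathfrak{B}$, $\overline{\mathfrak{B}}(d,d^* )=\overline{\mathfrak{B}}(d^*,d)=1$ (all other pairings of the summands being zero) is an associative (i.e. invariant) scalar product on $\overline{\mathcal{A}}$.
   Context: A superalgebra is a finite-dimensional $\mathbb{Z}_2$-graded vector space $\mathcal{A}=\mathcal{A}_{\bar 0}\oplus\mathcal{A}_{\bar 1}$ over $\mathbb{K}$ with a bilinear product satisfying $\mathcal{A}_i\mathcal{A}_j\subset\mathcal{A}_{i+j}$; $|x|$ is the degree of a homogeneous $x$. Left Zinbiel: $(xy)z=x(yz)+(-1)^{|y||z|}x(zy)$; right Zinbiel: $x(yz)=(xy)z+(-1)^{|x||y|}(yx)z$ (for homogeneous elements); symmetric Zinbiel: both. ${\rm Ann}(\mathcal{A})=\{a: a\mathcal{A}=\mathcal{A}a=0\}$, and $\mathcal{A}^2$ is the span of all products. A quadratic Zinbiel superalgebra is a left (or right) Zinbiel superalgebra with an invariant (associative) scalar product, i.e. a non-degenerate bilinear form $\mathfrak{B}$ that is supersymmetric ($\mathfrak{B}(x,y)=(-1)^{|x||y|}\mathfrak{B}(y,x)$), invariant ($\mathfrak{B}(xy,z)=\mathfrak{B}(x,yz)$) and even ($\mathfrak{B}(\mathcal{A}_{\bar 0},\mathcal{A}_{\bar 1})=\mathfrak{B}(\mathcal{A}_{\bar 1},\mathcal{A}_{\bar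 0})=0$). Such a superalgebra is automatically symmetric Zinbiel. Admissible triple: let $\mathcal{A}$ be a symmetric Zinbiel superalgebra, $\delta,D$ homogeneous endomorphisms of $\mathcal{A}$ of degree $|d|$, and $\mathfrak{a}_0\in{\rm Ann}(\mathcal{A})\cap\mathcal{A}_{\bar 0}$. $(\delta,D,\mathfrak{a}_0)$ is admissible if for all homogeneous $x,y\in\mathcal{A}$: $\delta(xy)=(-1)^{|d||x|}x\delta(y)=\delta(x)y+(-1)^{|d||x|}D(x)y=-(-1)^{|y|(|x|+|d|)}D(y)x$; $\delta(x)y=(-1)^{|x||y|}\delta(y)x=-(-1)^{|d|(|x|+|y|)}xD(y)$; $D(xy)=(-1)^{|d||y|}D(x)y$; $\delta^2(x)=(-1)^{|d|}\delta^2(x)=-D^2(x)=(1+(-1)^{|d|})\mathfrak{a}_0x$; $\delta\circ D(x)=-(-1)^{|d|}D\circ\delta(x)=(-1)^{|d||x|}x\mathfrak{a}_0=-(-1)^{|d|(|x|+|d|)}\mathfrak{a}_0x$; $\delta(\mathfrak{a}_0)=D(\mathfrak{a}_0)=0$. Here $|d|=\bar 0$. *)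

theory Defs
  imports "HOL-Library.Z2" "HOL-Analysis.Product_Vector"
begin

definition koszul_sign :: "bit \<Rightarrow> 'k::field" where
  "koszul_sign i = (if i = 0 then 1 else - 1)"

text \<open>The algebras live on a whole type \<open>'a\<close>; \<open>G 0\<close> and \<open>G 1\<close> are the even and odd parts.
  Since \<open>0\<close> lies in both parts, a law ``for homogeneous elements'' is stated for all
  \<open>x \<in> G i\<close>, \<open>y \<in> G j\<close>; for \<open>x = 0\<close> it holds whatever degree is chosen.\<close>

locale superalgebra = vector_space scale
  for scale :: "'k::field \<Rightarrow> 'a::ab_group_add \<Rightarrow> 'a" +
  fixes G :: "bit \<Rightarrow> 'a set"
    and mult :: "'a \<Rightarrow> 'a \<Rightarrow> 'a"
  assumes finite_dimensional: "\<exists>Basis. finite_dimensional_vector_space scale Basis"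
    and subspace_grade: "\<And>i. subspace (G i)"
    and grade_inter: "G 0 \<inter> G 1 = {0}"
    and grade_sum: "\<And>x. \<exists>y\<in>G 0. \<exists>z\<in>G 1. x = y + z"
    and mult_linear_left: "\<And>y. Vector_Spaces.linear scale scale (\<lambda>x. mult x y)"
    and mult_linear_right: "\<And>x. Vector_Spaces.linear scale scale (\<lambda>y. mult x y)"
    and mult_grade: "\<And>i j x y. x \<in> G i \<Longrightarrow> y \<in> G j \<Longrightarrow> mult x y \<in> G (i + j)"

locale left_zinbiel_superalgebra = superalgebra +
  assumes left_zinbiel: "\<And>i j k x y z. x \<in> G i \<Longrightarrow> y \<in> G j \<Longrightarrow> z \<in> G k \<Longrightarrow>
    mult (mult x y) z = mult x (mult y z) + scale (koszul_sign (j * k)) (mult x (mult z y))"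

locale right_zinbiel_superalgebra = superalgebra +
  assumes right_zinbiel: "\<And>i j k x y z. x \<in> G i \<Longrightarrow> y \<in> G j \<Longrightarrow> z \<in> G k \<Longrightarrow>
    mult x (mult y z) = mult (mult x y) z + scale (koszul_sign (i * j)) (mult (mult y x) z)"

locale symmetric_zinbiel_superalgebra = left_zinbiel_superalgebra + right_zinbiel_superalgebra

locale invariant_scalar_product = superalgebra scale G mult
  for scale :: "'k::field \<Rightarrow> 'a::ab_group_add \<Rightarrow> 'a"
    and G :: "bit \<Rightarrow> 'a set"
    and mult :: "'a \<Rightarrow> 'a \<Rightarrow> 'a" +
  fixes B :: "'a \<Rightarrow> 'a \<Rightarrow> 'k"
  assumes form_linear_left: "\<And>y. Vector_Spaces.linear scale (*) (\<lambda>x. B x y)"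
    and form_linear_right: "\<And>x. Vector_Spaces.linear scale (*) (\<lambda>y. B x y)"
    and nondegenerate_left: "\<And>x. (\<And>y. B x y = 0) \<Longrightarrow> x = 0"
    and nondegenerate_right: "\<And>y. (\<And>x. B x y = 0) \<Longrightarrow> y = 0"
    and supersymmetric: "\<And>i j x y. x \<in> G i \<Longrightarrow> y \<in> G j \<Longrightarrow> B x y = koszul_sign (i * j) * B y x"
    and invariant: "\<And>x y z. B (mult x y) z = B x (mult y z)"
    and even_form: "\<And>x y. x \<in> G 0 \<Longrightarrow> y \<in> G 1 \<Longrightarrow> B x y = 0 \<and> B y x = 0"

locale quadratic_zinbiel_superalgebra = invariant_scalar_product +
  assumes left_or_right_zinbiel:
    "left_zinbiel_superalgebra scale G mult \<or> right_zinbiel_superalgebra scale G mult"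

definition annihilator :: "('a \<Rightarrow> 'a \<Rightarrow> 'a::zero) \<Rightarrow> 'a set" where
  "annihilator mult = {a. \<forall>x. mult a x = 0 \<and> mult x a = 0}"

definition algebra_square ::
  "('k::field \<Rightarrow> 'a::ab_group_add \<Rightarrow> 'a) \<Rightarrow> ('a \<Rightarrow> 'a \<Rightarrow> 'a) \<Rightarrow> 'a set" where
  "algebra_square smul mult = module.span smul {mult x y | x y. True}"

definition homogeneous_endomorphism ::
  "('k::field \<Rightarrow> 'a::ab_group_add \<Rightarrow> 'a) \<Rightarrow> (bit \<Rightarrow> 'a set) \<Rightarrow> bit \<Rightarrow> ('a \<Rightarrow> 'a) \<Rightarrow> bool" where
  "homogeneous_endomorphism smul G d f \<longleftrightarrow>
    Vector_Spaces.linear smul smul f \<and> (\<forall>i. f ` G i \<subseteq> G (i + d))"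

definition is_adjoint :: "('a \<Rightarrow> 'a \<Rightarrow> 'k) \<Rightarrow> ('a \<Rightarrow> 'a) \<Rightarrow> ('a \<Rightarrow> 'a) \<Rightarrow> bool" where
  "is_adjoint B f g \<longleftrightarrow> (\<forall>x y. B (f x) y = B x (g y))"

text \<open>Each assumption below is a chain of equalities, split into equations with the same
  left-hand side; \<open>d\<close> is the common degree of \<open>\<delta>\<close> and \<open>D\<close>.\<close>

locale admissible_triple = symmetric_zinbiel_superalgebra scale G mult
  for scale :: "'k::field \<Rightarrow> 'a::ab_group_add \<Rightarrow> 'a"
    and G :: "bit \<Rightarrow> 'a set"
    and mult :: "'a \<Rightarrow> 'a \<Rightarrow> 'a" (infixl "\<bullet>" 70) +
  fixes d :: bit
    and \<delta> D :: "'a \<Rightarrow> 'a"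
    and a0 :: 'a
  assumes endo_\<delta>: "homogeneous_endomorphism scale G d \<delta>"
    and endo_D: "homogeneous_endomorphism scale G d D"
    and a0_mem: "a0 \<in> annihilator (\<bullet>) \<inter> G 0"
    and \<delta>_mult: "\<And>i j x y. x \<in> G i \<Longrightarrow> y \<in> G j \<Longrightarrow>
        \<delta> (x \<bullet> y) = scale (koszul_sign (d * i)) (x \<bullet> \<delta> y) \<and>
        \<delta> (x \<bullet> y) = \<delta> x \<bullet> y + scale (koszul_sign (d * i)) (D x \<bullet> y) \<and>
        \<delta> (x \<bullet> y) = - scale (koszul_sign (j * (i + d))) (D y \<bullet> x)"
    and \<delta>_left: "\<And>i j x y. x \<in> G i \<Longrightarrow> y \<in> G j \<Longrightarrow>
        \<delta> x \<bullet> y = scale (koszul_sign (i * j)) (\<delta> y \<bullet> x) \<and>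
        \<delta> x \<bullet> y = - scale (koszul_sign (d * (i + j))) (x \<bullet> D y)"
    and D_mult: "\<And>i j x y. x \<in> G i \<Longrightarrow> y \<in> G j \<Longrightarrow>
        D (x \<bullet> y) = scale (koszul_sign (d * j)) (D x \<bullet> y)"
    and \<delta>_\<delta>: "\<And>i x. x \<in> G i \<Longrightarrow>
        \<delta> (\<delta> x) = scale (koszul_sign d) (\<delta> (\<delta> x)) \<and>
        \<delta> (\<delta> x) = - D (D x) \<and>
        \<delta> (\<delta> x) = scale (1 + koszul_sign d) (a0 \<bullet> x)"
    and \<delta>_D: "\<And>i x. x \<in> G i \<Longrightarrow>
        \<delta> (D x) = - scale (koszul_sign d) (D (\<delta> x)) \<and>
        \<delta> (D x) = scale (koszul_sign (d * i)) (x \<bullet> a0) \<and>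
        \<delta> (D x) = - scale (koszul_sign (d * (i + d))) (a0 \<bullet> x)"
    and \<delta>_a0: "\<delta> a0 = 0"
    and D_a0: "D a0 = 0"

text \<open>The extended space is \<open>'k \<times> 'a \<times> 'k\<close>, where \<open>(p, x, q)\<close> stands for
  \<open>p d\<^sup>* + x + q d\<close>. The product and the form are the bilinear extensions of
  their values on the summands; these values are recovered in the lemmas below.\<close>

definition ext_scale ::
  "('k::field \<Rightarrow> 'a::ab_group_add \<Rightarrow> 'a) \<Rightarrow> 'k \<Rightarrow> 'k \<times> 'a \<times> 'k \<Rightarrow> 'k \<times> 'a \<times> 'k" where
  "ext_scale smul = module_prod.scale (*) (module_prod.scale smul (*))"

definition ext_grade :: "(bit \<Rightarrow> 'a set) \<Rightarrow> bit \<Rightarrow> ('k::field \<times> 'a \<times> 'k) set" where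
  "ext_grade G i = (if i = 0 then UNIV \<times> G 0 \<times> UNIV else {0} \<times> G 1 \<times> {0})"

definition ext_mult ::
  "('k::field \<Rightarrow> 'a::ab_group_add \<Rightarrow> 'a) \<Rightarrow> ('a \<Rightarrow> 'a \<Rightarrow> 'a) \<Rightarrow> ('a \<Rightarrow> 'a \<Rightarrow> 'k) \<Rightarrow>
   ('a \<Rightarrow> 'a) \<Rightarrow> ('a \<Rightarrow> 'a) \<Rightarrow> 'a \<Rightarrow> 'k \<Rightarrow> 'k \<times> 'a \<times> 'k \<Rightarrow> 'k \<times> 'a \<times> 'k \<Rightarrow> 'k \<times> 'a \<times> 'k" where
  "ext_mult smul mult B \<delta> \<delta>s a0 \<alpha> = (\<lambda>(p, x, q) (p', x', q').
     (q * q' * \<alpha> + q * B x' a0 + B (\<delta> x) x' + q' * B x a0,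
      smul (q * q') a0 + smul q (\<delta> x') + mult x x' + smul q' (\<delta>s x),
      0))"

definition ext_form ::
  "('a \<Rightarrow> 'a \<Rightarrow> 'k) \<Rightarrow> 'k \<times> 'a \<times> 'k \<Rightarrow> 'k \<times> 'a \<times> 'k \<Rightarrow> 'k::field" where
  "ext_form B = (\<lambda>(p, x, q) (p', x', q'). B x x' + p * q' + q * p')"

abbreviation ext_dual :: "'k::field \<times> 'a::ab_group_add \<times> 'k" where
  "ext_dual \<equiv> (1, 0, 0)"

abbreviation ext_d :: "'k::field \<times> 'a::ab_group_add \<times> 'k" where
  "ext_d \<equiv> (0, 0, 1)"

abbreviation ext_emb :: "'a::ab_group_add \<Rightarrow> 'k::field \<times> 'a \<times> 'k" where
  "ext_emb x \<equiv> (0, x, 0)"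

context invariant_scalar_product
begin

lemma linear_zero: "Vector_Spaces.linear s1 s2 f \<Longrightarrow> f 0 = 0"
  by (metis module_hom.zero linear_iff_module_hom)

lemma form_zero [simp]: "B 0 y = 0" "B x 0 = 0"
  using linear_zero[OF form_linear_left] linear_zero[OF form_linear_right] by auto

lemma product_zero [simp]: "mult 0 y = 0" "mult x 0 = 0"
  using linear_zero[OF mult_linear_left] linear_zero[OF mult_linear_right] by auto

lemma ext_scale_eq: "ext_scale scale c (p, x, q) = (c * p, scale c x, c * q)"
proof -
  have k: "module ((*) :: 'k \<Rightarrow> 'k \<Rightarrow> 'k)"
    by unfold_locales (simp_all add: algebra_simps)
  interpret inner: module_prod scale "(*) :: 'k \<Rightarrow> 'k \<Rightarrow> 'k"
    using k module_axioms by (simp add: module_prod_def module_pair_def)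
  interpret outer: module_prod "(*) :: 'k \<Rightarrow> 'k \<Rightarrow> 'k" inner.scale
    using k inner.p.module_axioms by (simp add: module_prod_def module_pair_def)
  show ?thesis
    by (simp add: ext_scale_def outer.scale_prod inner.scale_prod)
qed

lemma ext_mult_values:
  fixes a0 :: 'a and \<alpha> :: 'k
  assumes "Vector_Spaces.linear scale scale \<delta>" "Vector_Spaces.linear scale scale \<delta>s"
  defines "prd \<equiv> ext_mult scale mult B \<delta> \<delta>s a0 \<alpha>"
  shows "prd ext_d ext_d = ext_emb a0 + ext_scale scale \<alpha> ext_dual"
    and "prd ext_d (ext_emb x) = ext_emb (\<delta> x) + ext_scale scale (B x a0) ext_dual"
    and "prd (ext_emb x) (ext_emb y) = ext_emb (mult x y) + ext_scale scale (B (\<delta> x) y) ext_dual"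
    and "prd (ext_emb x) ext_d = ext_emb (\<delta>s x) + ext_scale scale (B x a0) ext_dual"
    and "prd ext_dual v = 0"
    and "prd v ext_dual = 0"
proof -
  have [simp]: "\<delta> 0 = 0" "\<delta>s 0 = 0"
    using assms(1,2) linear_zero by auto
  show "prd ext_d ext_d = ext_emb a0 + ext_scale scale \<alpha> ext_dual"
    and "prd ext_d (ext_emb x) = ext_emb (\<delta> x) + ext_scale scale (B x a0) ext_dual"
    and "prd (ext_emb x) (ext_emb y) = ext_emb (mult x y) + ext_scale scale (B (\<delta> x) y) ext_dual"
    and "prd (ext_emb x) ext_d = ext_emb (\<delta>s x) + ext_scale scale (B x a0) ext_dual"
    and "prd ext_dual v = 0"
    and "prd v ext_dual = 0"
    by (simp_all add: prd_def ext_mult_def ext_scale_eq zero_prod_def split: prod.split)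
qed

lemma ext_form_values:
  "ext_form B (ext_emb x) (ext_emb y) = B x y"
  "ext_form B ext_d ext_dual = 1" "ext_form B ext_dual ext_d = 1"
  "ext_form B ext_d ext_d = 0" "ext_form B ext_dual ext_dual = 0"
  "ext_form B ext_d (ext_emb x) = 0" "ext_form B (ext_emb x) ext_d = 0"
  "ext_form B ext_dual (ext_emb x) = 0" "ext_form B (ext_emb x) ext_dual = 0"
  by (simp_all add: ext_form_def)

end

end

theory Submission
  imports Defs "HOL-Analysis.Cartesian_Space"
begin

text \<open>The hypotheses force \<open>\<delta>\<close>, its adjoint and \<open>a0\<close> to be invisible in any product of three
  elements: the images of both maps lie in the annihilator, both maps kill products, \<open>a0\<close> and
  each other's images, and \<open>a0\<close> is isotropic and orthogonal to both images and to all products.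
  Hence \<open>(u \<odot> v) \<odot> w\<close> and \<open>u \<odot> (v \<odot> w)\<close> are just the triple products of the middle
  components, and the Zinbiel identities are inherited. Invariance of the extended form
  matches term by term, once the adjoint relation is flipped by supersymmetry.\<close>

lemma even_endomorphism:
  assumes "homogeneous_endomorphism smul G 0 f"
  shows "f (x + y) = f x + f y" and "f (smul c x) = smul c (f x)" and "x \<in> G i \<Longrightarrow> f x \<in> G i"
proof -
  show "f (x + y) = f x + f y" "f (smul c x) = smul c (f x)"
    using assms by (simp_all add: homogeneous_endomorphism_def linear_iff_module_hom module_hom_iff)
  have "f ` G (i + 0) \<subseteq> G (i + 0)"
    using assms unfolding homogeneous_endomorphism_def by (metis add_0_right)
  then show "x \<in> G i \<Longrightarrow> f x \<in> G i"
    unfolding add_0_right by blast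
qed

context superalgebra
begin

lemma homogeneous_cases:
  assumes "\<And>y z. y \<in> G 0 \<Longrightarrow> z \<in> G 1 \<Longrightarrow> P (y + z)"
  shows "P x"
  using grade_sum[of x] assms by blast

lemma mult_add: "mult (x + y) z = mult x z + mult y z" "mult x (y + z) = mult x y + mult x z"
  using mult_linear_left[of z] mult_linear_right[of x]
  by (simp_all add: linear_iff_module_hom module_hom_iff)

lemma mult_scale: "mult (scale c x) z = scale c (mult x z)" "mult x (scale c z) = scale c (mult x z)"
  using mult_linear_left[of z] mult_linear_right[of x]
  by (simp_all add: linear_iff_module_hom module_hom_iff)

end

section \<open>Supersymmetry of the form and adjoint maps\<close>

context invariant_scalar_product
begin

lemma form_add: "B (x + y) z = B x z + B y z" "B x (y + z) = B x y + B x z"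
  using form_linear_left[of z] form_linear_right[of x]
  by (simp_all add: linear_iff_module_hom module_hom_iff)

lemma form_scale: "B (scale c x) z = c * B x z" "B x (scale c z) = c * B x z"
  using form_linear_left[of z] form_linear_right[of x]
  by (simp_all add: linear_iff_module_hom module_hom_iff)

text \<open>Against the even part of \<open>x\<close> the supersymmetry sign is 1; the odd part is
  orthogonal to \<open>a\<close> on both sides.\<close>

lemma form_commute_even:
  assumes "a \<in> G 0"
  shows "B a x = B x a"
proof (rule homogeneous_cases[of "\<lambda>x. B a x = B x a"])
  fix y z assume "y \<in> G 0" "z \<in> G 1"
  then show "B a (y + z) = B (y + z) a"
    using assms supersymmetric[of a 0 y 0] even_form[of a z]
    by (simp add: form_add koszul_sign_def)
qed

text \<open>Moving \<open>f\<close> to the other slot costs two applications of supersymmetry. Since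
  \<open>f\<close> and \<open>g\<close> preserve degrees, both produce the same sign, and the signs
  cancel. Additivity removes the restriction to homogeneous elements.\<close>

lemma adjoint_flip:
  assumes f: "homogeneous_endomorphism scale G 0 f" and g: "homogeneous_endomorphism scale G 0 g"
    and adj: "is_adjoint B f g"
  shows "B (g x) y = B x (f y)"
proof -
  have eq: "B (g x) y = B x (f y)" if "x \<in> G i" "y \<in> G j" for i j x y
  proof -
    have "B (g x) y = koszul_sign (i * j) * B y (g x)"
      using supersymmetric[OF even_endomorphism(3)[OF g that(1)] that(2)] .
    also have "B y (g x) = B (f y) x"
      using adj by (simp add: is_adjoint_def)
    also have "koszul_sign (i * j) * B (f y) x = B x (f y)"
      using supersymmetric[OF that(1) even_endomorphism(3)[OF f that(2)]] by simp
    finally show ?thesis .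
  qed
  obtain x0 x1 y0 y1 where "x0 \<in> G 0" "x1 \<in> G 1" "x = x0 + x1"
      "y0 \<in> G 0" "y1 \<in> G 1" "y = y0 + y1"
    using grade_sum by metis
  then show ?thesis
    by (simp add: even_endomorphism(1)[OF f] even_endomorphism(1)[OF g] form_add eq)
qed

section \<open>Linear structure of the extended space\<close>

lemma vector_space_ext: "vector_space (ext_scale scale)"
  by unfold_locales (auto simp: ext_scale_eq algebra_simps)

lemma finite_dimensional_ext:
  "\<exists>Basis. finite_dimensional_vector_space (ext_scale scale) Basis"
proof -
  obtain S where S: "finite_dimensional_vector_space scale S"
    using finite_dimensional by blast
  \<comment> \<open>The field has basis \<open>{1}\<close> over itself, so a basis of the extended
    space arises from \<open>S\<close> by forming the product basis twice, along the nesting in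
    \<open>ext_scale\<close>.\<close>
  note k = vector_space_over_itself.finite_dimensional_vector_space_axioms[where 'a = 'k]
  interpret inner: finite_dimensional_vector_space_prod scale "(*) :: 'k \<Rightarrow> 'k \<Rightarrow> 'k" S "{1}"
    using S k by (simp add: finite_dimensional_vector_space_prod_def
      finite_dimensional_vector_space_pair_def vector_space_prod_def vector_space_pair_def
      finite_dimensional_vector_space_def)
  interpret outer: finite_dimensional_vector_space_prod "(*) :: 'k \<Rightarrow> 'k \<Rightarrow> 'k" inner.scale
      "{1}" inner.Basis_pair
    using k inner.p.finite_dimensional_vector_space_axioms
    by (simp add: finite_dimensional_vector_space_prod_def
      finite_dimensional_vector_space_pair_def vector_space_prod_def vector_space_pair_def
      finite_dimensional_vector_space_def)
  show ?thesis
    unfolding ext_scale_def using outer.p.finite_dimensional_vector_space_axioms by blast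
qed

end

text \<open>The vanishing conditions are stated for all elements, free of degrees and signs, so that
  they act as rewrite rules when products of the extension are expanded.\<close>

locale double_extension = invariant_scalar_product scale G mult B
  for scale :: "'k::field \<Rightarrow> 'a::ab_group_add \<Rightarrow> 'a"
    and G :: "bit \<Rightarrow> 'a set"
    and mult :: "'a \<Rightarrow> 'a \<Rightarrow> 'a"
    and B :: "'a \<Rightarrow> 'a \<Rightarrow> 'k" +
  fixes \<delta> \<delta>s :: "'a \<Rightarrow> 'a"
    and a0 :: 'a
    and \<alpha> :: 'k
  assumes zinbiel: "symmetric_zinbiel_superalgebra scale G mult"
    and endo: "homogeneous_endomorphism scale G 0 \<delta>" "homogeneous_endomorphism scale G 0 \<delta>s"
    and adjoint: "is_adjoint B \<delta> \<delta>s"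
    and mult_\<delta>: "mult (\<delta> x) y = 0" "mult x (\<delta> y) = 0"
    and mult_\<delta>s: "mult (\<delta>s x) y = 0" "mult x (\<delta>s y) = 0"
    and mult_a0: "mult a0 y = 0" "mult x a0 = 0"
    and \<delta>_product: "\<delta> (mult x y) = 0" "\<delta>s (mult x y) = 0"
    and \<delta>_square: "\<delta> (\<delta> x) = 0" "\<delta> (\<delta>s x) = 0" "\<delta>s (\<delta> x) = 0" "\<delta>s (\<delta>s x) = 0"
    and \<delta>_a0: "\<delta> a0 = 0" "\<delta>s a0 = 0"
    and a0_even: "a0 \<in> G 0"
    and a0_isotropic: "B a0 a0 = 0"
begin

abbreviation ext_prod (infixl "\<odot>" 70) where
  "(\<odot>) \<equiv> ext_mult scale mult B \<delta> \<delta>s a0 \<alpha>"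

lemma ext_prod_eq:
  "(p, x, q) \<odot> (p', x', q') =
     (q * q' * \<alpha> + q * B x' a0 + B (\<delta> x) x' + q' * B x a0,
      scale (q * q') a0 + scale q (\<delta> x') + mult x x' + scale q' (\<delta>s x), 0)"
  by (simp add: ext_mult_def)

lemmas \<delta>_add = even_endomorphism(1)[OF endo(1)] even_endomorphism(1)[OF endo(2)]
lemmas \<delta>_scale = even_endomorphism(2)[OF endo(1)] even_endomorphism(2)[OF endo(2)]
lemmas \<delta>_grade = even_endomorphism(3)[OF endo(1)] even_endomorphism(3)[OF endo(2)]

lemma form_\<delta>: "B (\<delta> x) y = B x (\<delta>s y)" "B (\<delta>s x) y = B x (\<delta> y)"
  using adjoint adjoint_flip[OF endo adjoint] by (simp_all add: is_adjoint_def)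

text \<open>The inner product has no \<open>d\<close> part, and its \<open>d*\<close> part
  annihilates everything. Its middle component \<open>m\<close> is \<open>mult x x'\<close> plus
  terms in \<open>a0\<close> and the images of the two maps. Those terms multiply to zero, both maps
  kill \<open>m\<close>, and \<open>m\<close> is orthogonal to \<open>a0\<close>, so every scalar
  term disappears.\<close>

lemma ext_prod_left:
  "((p, x, q) \<odot> (p', x', q')) \<odot> (p'', x'', q'') = (0, mult (mult x x') x'', 0)"
  by (simp add: ext_prod_eq \<delta>_add \<delta>_scale mult_add mult_scale form_add form_scale mult_\<delta> mult_\<delta>s
      mult_a0 \<delta>_product \<delta>_square \<delta>_a0 a0_isotropic form_\<delta> invariant)

text \<open>As on the left, with one new scalar \<open>B (\<delta> x) m\<close>; it vanishes because
  the adjoint moves onto \<open>m\<close> and kills it.\<close>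

lemma ext_prod_right:
  "(p, x, q) \<odot> ((p', x', q') \<odot> (p'', x'', q'')) = (0, mult x (mult x' x''), 0)"
  by (simp add: ext_prod_eq \<delta>_add \<delta>_scale mult_add mult_scale form_add form_scale mult_\<delta> mult_\<delta>s
      mult_a0 \<delta>_product \<delta>_square \<delta>_a0 a0_isotropic form_\<delta> invariant)

section \<open>Grading and Zinbiel identities of the extension\<close>

lemma ext_grade_middle: "(p, x, q) \<in> ext_grade G i \<Longrightarrow> x \<in> G i"
  by (auto simp: ext_grade_def split: if_splits)

lemma ext_prod_grade:
  assumes "u \<in> ext_grade G i" "v \<in> ext_grade G j"
  shows "u \<odot> v \<in> ext_grade G (i + j)"
proof -
  obtain p x q p' x' q' where uv: "u = (p, x, q)" "v = (p', x', q')"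
    by (metis prod_cases3)
  have x: "x \<in> G i" and x': "x' \<in> G j"
    using assms ext_grade_middle uv by auto
  have mid: "mult x x' \<in> G (i + j)"
    using mult_grade[OF x x'] .
  note sub = subspace_add[OF subspace_grade] subspace_scale[OF subspace_grade]
  consider "i = 0" "j = 0" | "i = 0" "j = 1" | "i = 1" "j = 0" | "i = 1" "j = 1"
    by (metis bit_not_one_iff)
  then show ?thesis
  proof cases
    case 1
    then show ?thesis
      using x x' mid by (auto simp: uv ext_prod_eq ext_grade_def intro!: sub a0_even \<delta>_grade)
  next
    \<comment> \<open>An odd element has no \<open>d*\<close> part, so the scalar component must
      vanish. It consists of pairings between even and odd elements, which are zero as the form is
      even; the next case is the mirror image.\<close>
    case 2
    then show ?thesis
      using assms x x' mid even_form[OF \<delta>_grade(1)[of x 0], of x'] even_form[OF a0_even, of x']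
      by (auto simp: uv ext_prod_eq ext_grade_def intro!: sub \<delta>_grade)
  next
    case 3
    then show ?thesis
      using assms x x' mid even_form[OF _ \<delta>_grade(1)[of x 1], of x'] even_form[OF a0_even, of x]
      by (auto simp: uv ext_prod_eq ext_grade_def intro!: sub \<delta>_grade)
  next
    case 4
    then show ?thesis
      using assms x x' mid by (auto simp: uv ext_prod_eq ext_grade_def)
  qed
qed

lemma superalgebra_ext: "superalgebra (ext_scale scale) (ext_grade G) (\<odot>)"
proof -
  interpret E: vector_space "ext_scale scale"
    by (rule vector_space_ext)
  show ?thesis
  proof (intro superalgebra.intro superalgebra_axioms.intro vector_space_ext)
    show "\<exists>Basis. finite_dimensional_vector_space (ext_scale scale) Basis"
      by (rule finite_dimensional_ext)
    show "E.subspace (ext_grade G i)" for i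
      using subspace_grade[of 0] subspace_grade[of 1]
      by (auto simp: E.subspace_def subspace_def ext_grade_def ext_scale_eq zero_prod_def)
    show "ext_grade G 0 \<inter> ext_grade G 1 = {0}"
      using grade_inter by (auto simp: ext_grade_def zero_prod_def)
    show "\<exists>y\<in>ext_grade G 0. \<exists>z\<in>ext_grade G 1. u = y + z" for u
    proof -
      obtain p x q where u: "u = (p, x, q)"
        by (metis prod_cases3)
      obtain y z where "y \<in> G 0" "z \<in> G 1" "x = y + z"
        using grade_sum by blast
      then have "(p, y, q) \<in> ext_grade G 0" "(0, z, 0) \<in> ext_grade G 1"
          "u = (p, y, q) + (0, z, 0)"
        by (simp_all add: u ext_grade_def)
      then show ?thesis by blast
    qed
    show "Vector_Spaces.linear (ext_scale scale) (ext_scale scale) (\<lambda>u. u \<odot> v)" for v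
      unfolding linear_iff_module_hom module_hom_iff
      using E.module_axioms
      by (cases v) (auto simp: ext_prod_eq ext_scale_eq \<delta>_add \<delta>_scale mult_add mult_scale form_add
          form_scale algebra_simps)
    show "Vector_Spaces.linear (ext_scale scale) (ext_scale scale) (\<lambda>v. u \<odot> v)" for u
      unfolding linear_iff_module_hom module_hom_iff
      using E.module_axioms
      by (cases u) (auto simp: ext_prod_eq ext_scale_eq \<delta>_add \<delta>_scale mult_add mult_scale form_add
          form_scale algebra_simps)
    show "u \<odot> v \<in> ext_grade G (i + j)"
      if "u \<in> ext_grade G i" "v \<in> ext_grade G j" for i j u v
      using ext_prod_grade[OF that] .
  qed
qed

text \<open>Both identities compare triple products only, and these depend only on the middle
  components, which have the degrees of the full elements. The signs therefore agree with those in
  the original algebra.\<close>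

lemma symmetric_zinbiel_ext:
  "symmetric_zinbiel_superalgebra (ext_scale scale) (ext_grade G) (\<odot>)"
proof -
  interpret Z: symmetric_zinbiel_superalgebra scale G mult
    by (rule zinbiel)
  interpret E: superalgebra "ext_scale scale" "ext_grade G" "(\<odot>)"
    by (rule superalgebra_ext)
  show ?thesis
  proof
    fix i j k and u v w :: "'k \<times> 'a \<times> 'k"
    assume "u \<in> ext_grade G i" "v \<in> ext_grade G j" "w \<in> ext_grade G k"
    moreover obtain p x q p' x' q' p'' x'' q''
      where uvw: "u = (p, x, q)" "v = (p', x', q')" "w = (p'', x'', q'')"
      by (metis prod_cases3)
    ultimately have x: "x \<in> G i" "x' \<in> G j" "x'' \<in> G k"
      using ext_grade_middle by auto
    show "(u \<odot> v) \<odot> w = u \<odot> (v \<odot> w) + ext_scale scale (koszul_sign (j * k)) (u \<odot> (w \<odot> v))"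
      by (simp add: uvw ext_prod_left ext_prod_right ext_scale_eq Z.left_zinbiel[OF x])
    show "u \<odot> (v \<odot> w) = (u \<odot> v) \<odot> w + ext_scale scale (koszul_sign (i * j)) ((v \<odot> u) \<odot> w)"
      by (simp add: uvw ext_prod_left ext_prod_right ext_scale_eq Z.right_zinbiel[OF x])
  qed
qed

text \<open>Comparing coefficients: the \<open>q''\<close> terms match by the adjoint relation, the
  \<open>q'\<close> terms by its flipped version, and the \<open>q * q'\<close> terms because the
  even element \<open>a0\<close> commutes under \<open>B\<close>; the term free of \<open>q\<close>,
  \<open>q'\<close>, \<open>q''\<close> is invariance of \<open>B\<close>.\<close>

lemma invariant_ext:
  fixes u v w :: "'k \<times> 'a \<times> 'k"
  shows "ext_form B (u \<odot> v) w = ext_form B u (v \<odot> w)"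
proof -
  obtain p x q p' x' q' p'' x'' q''
    where uvw: "u = (p, x, q)" "v = (p', x', q')" "w = (p'', x'', q'')"
    by (metis prod_cases3)
  show ?thesis
    by (simp add: uvw ext_prod_eq ext_form_def form_add form_scale form_\<delta> invariant
        form_commute_even[OF a0_even] algebra_simps)
qed

text \<open>The span of \<open>d\<close> and \<open>d*\<close> is an even hyperbolic plane
  orthogonal to the original algebra, so nondegeneracy and supersymmetry carry over from
  \<open>B\<close>.\<close>

lemma invariant_scalar_product_ext:
  "invariant_scalar_product (ext_scale scale) (ext_grade G) (\<odot>) (ext_form B)"
proof -
  interpret E: superalgebra "ext_scale scale" "ext_grade G" "(\<odot>)"
    by (rule superalgebra_ext)
  show ?thesis
  proof (intro invariant_scalar_product.intro invariant_scalar_product_axioms.intro superalgebra_ext)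
    show "Vector_Spaces.linear (ext_scale scale) (*) (\<lambda>u. ext_form B u v)" for v
      unfolding linear_iff_module_hom module_hom_iff
      using E.module_axioms vector_space_over_itself.module_axioms
      by (cases v) (auto simp: ext_form_def ext_scale_eq form_add form_scale algebra_simps)
    show "Vector_Spaces.linear (ext_scale scale) (*) (\<lambda>v. ext_form B u v)" for u
      unfolding linear_iff_module_hom module_hom_iff
      using E.module_axioms vector_space_over_itself.module_axioms
      by (cases u) (auto simp: ext_form_def ext_scale_eq form_add form_scale algebra_simps)
    show "u = 0" if nd: "\<And>v. ext_form B u v = 0" for u
    proof -
      obtain p x q where u: "u = (p, x, q)"
        by (metis prod_cases3)
      \<comment> \<open>Pairing with embedded elements detects \<open>x\<close>; afterwards
        \<open>d\<close> detects \<open>p\<close> and \<open>d*\<close> detects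
        \<open>q\<close>.\<close>
      have "x = 0"
        by (rule nondegenerate_left) (use nd[of "ext_emb _"] in \<open>simp add: u ext_form_def\<close>)
      then show ?thesis
        using nd[of ext_d] nd[of ext_dual] by (simp add: u ext_form_def zero_prod_def)
    qed
    show "v = 0" if nd: "\<And>u. ext_form B u v = 0" for v
    proof -
      obtain p x q where v: "v = (p, x, q)"
        by (metis prod_cases3)
      have "x = 0"
        by (rule nondegenerate_right) (use nd[of "ext_emb _"] in \<open>simp add: v ext_form_def\<close>)
      then show ?thesis
        using nd[of ext_d] nd[of ext_dual] by (simp add: v ext_form_def zero_prod_def)
    qed
    show "ext_form B u v = koszul_sign (i * j) * ext_form B v u"
      if uv: "u \<in> ext_grade G i" "v \<in> ext_grade G j" for i j u v
    proof -
      obtain p x q p' x' q' where eq: "u = (p, x, q)" "v = (p', x', q')"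
        by (metis prod_cases3)
      have "B x x' = koszul_sign (i * j) * B x' x"
        using supersymmetric ext_grade_middle uv eq by blast
      then show ?thesis
        using uv by (auto simp: eq ext_form_def ext_grade_def koszul_sign_def split: if_splits)
    qed
    show "ext_form B (u \<odot> v) w = ext_form B u (v \<odot> w)" for u v w
      by (rule invariant_ext)
    show "ext_form B u v = 0 \<and> ext_form B v u = 0"
      if "u \<in> ext_grade G 0" "v \<in> ext_grade G 1" for u v
      using that even_form by (auto simp: ext_grade_def ext_form_def)
  qed
qed

end

section \<open>From admissibility to the vanishing conditions\<close>

theorem theorem32:
  fixes scale :: "'k::field \<Rightarrow> 'a::ab_group_add \<Rightarrow> 'a"
    and G :: "bit \<Rightarrow> 'a set"
    and mult :: "'a \<Rightarrow> 'a \<Rightarrow> 'a"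
    and B :: "'a \<Rightarrow> 'a \<Rightarrow> 'k"
    and \<delta> \<delta>s :: "'a \<Rightarrow> 'a"
    and a0 :: 'a
    and \<alpha> :: 'k
  assumes "quadratic_zinbiel_superalgebra scale G mult B"
    and "homogeneous_endomorphism scale G 0 \<delta>"
    and "is_adjoint B \<delta> \<delta>s"
    and "admissible_triple scale G mult 0 \<delta> \<delta>s a0"
    and "range \<delta> \<subseteq> annihilator mult"
    and "\<delta> ` algebra_square scale mult = {0}"
    and "\<delta> \<circ> \<delta> = (\<lambda>_. 0)" and "\<delta> \<circ> \<delta>s = (\<lambda>_. 0)" and "\<delta>s \<circ> \<delta> = (\<lambda>_. 0)"
    and "a0 \<in> annihilator mult \<inter> G 0"
    and "B a0 a0 = 0"
  shows "symmetric_zinbiel_superalgebra (ext_scale scale) (ext_grade G)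
           (ext_mult scale mult B \<delta> \<delta>s a0 \<alpha>) \<and>
         invariant_scalar_product (ext_scale scale) (ext_grade G)
           (ext_mult scale mult B \<delta> \<delta>s a0 \<alpha>) (ext_form B)"
proof -
  interpret Q: quadratic_zinbiel_superalgebra scale G mult B
    by fact
  interpret T: admissible_triple scale G mult 0 \<delta> \<delta>s a0
    by fact
  have sq: "\<delta> (\<delta> x) = 0" "\<delta> (\<delta>s x) = 0" "\<delta>s (\<delta> x) = 0" for x
    using assms(7,8,9) by (simp_all add: fun_eq_iff)
  have \<delta>_ann: "mult (\<delta> x) y = 0" "mult y (\<delta> x) = 0" for x y
    using assms(5) by (auto simp: annihilator_def)
  have "mult x y \<in> algebra_square scale mult" for x y
    unfolding algebra_square_def by (rule Q.span_base) blast
  then have \<delta>_prod: "\<delta> (mult x y) = 0" for x y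
    using assms(6) by blast
  \<comment> \<open>In degree 0 the expansion of \<open>\<delta> (mult x y)\<close> leaves only
    \<open>mult (\<delta>s x) y\<close>, the relation between \<open>mult (\<delta> x) y\<close> and
    \<open>mult x (\<delta>s y)\<close> kills the latter, and the square of \<open>\<delta>s\<close>
    is minus that of \<open>\<delta>\<close>.\<close>
  have hom: "mult (\<delta>s x) y = 0" "mult x (\<delta>s y) = 0" "\<delta>s (\<delta>s x) = 0"
    if "x \<in> G i" "y \<in> G j" for i j x y
    using T.\<delta>_mult[OF that] T.\<delta>_left[OF that] T.\<delta>_\<delta>[OF that(1)]
    by (simp_all add: \<delta>_ann \<delta>_prod sq koszul_sign_def)
  have \<delta>s_ann: "mult (\<delta>s x) y = 0" "mult x (\<delta>s y) = 0" "\<delta>s (\<delta>s x) = 0" for x y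
  proof -
    obtain x0 x1 y0 y1 where x: "x0 \<in> G 0" "x1 \<in> G 1" "x = x0 + x1"
        and y: "y0 \<in> G 0" "y1 \<in> G 1" "y = y0 + y1"
      using Q.grade_sum by metis
    show "mult (\<delta>s x) y = 0" "mult x (\<delta>s y) = 0" "\<delta>s (\<delta>s x) = 0"
      using x y hom by (auto simp: even_endomorphism(1)[OF T.endo_D] Q.mult_add)
  qed
  have \<delta>s_prod: "\<delta>s (mult x y) = 0" for x y
  \<comment> \<open>Pairing with any \<open>z\<close> moves the adjoint onto \<open>z\<close> as
    \<open>\<delta>\<close>; invariance then exposes a product with \<open>\<delta> z\<close>, which
    lies in the annihilator.\<close>
  proof (rule Q.nondegenerate_right)
    fix z
    have "B z (\<delta>s (mult x y)) = B (\<delta> z) (mult x y)"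
      using assms(3) by (simp add: is_adjoint_def)
    also have "\<dots> = B (mult (\<delta> z) x) y"
      by (simp add: Q.invariant)
    finally show "B z (\<delta>s (mult x y)) = 0"
      by (simp add: \<delta>_ann)
  qed
  interpret double_extension scale G mult B \<delta> \<delta>s a0 \<alpha>
    using assms(3,10,11)
    by unfold_locales (auto simp: \<delta>_ann \<delta>s_ann \<delta>_prod \<delta>s_prod sq T.\<delta>_a0 T.D_a0 T.endo_\<delta> T.endo_D
        T.symmetric_zinbiel_superalgebra_axioms annihilator_def)
  show ?thesis
    using symmetric_zinbiel_ext invariant_scalar_product_ext by blast
qed

end
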